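(* The number of $2\times 2$ MDS matrices over the finite field $\mathbb{F}_{2^r}$ is $(2^r-1)^3(2^r-2)$.
   Context: A square matrix $M$ over a field is an MDS matrix if every square submatrix of $M$ (formed by any $i$ rows and any $i$ columns, $i\ge 1$, including $M$ itself) is nonsingular. *)

theory Defs
  imports
    "HOL-Library.Cardinality"
    "Jordan_Normal_Form.DL_Submatrix"
begin

(* Index sets start at 0. I and J are chosen independently, so the submatrices are not only
   the principal ones. *)
definition mds_matrix :: "'a :: field mat \<Rightarrow> bool" where
  "mds_matrix M \<longleftrightarrow>
     square_mat M \<and>
     (\<forall>I J. I \<subseteq> {..<dim_row M} \<longrightarrow> J \<subseteq> {..<dim_col M} \<longrightarrow>
        card I = card J \<longrightarrow> card I \<ge> 1 \<longrightarrow> invertible_mat (submatrix M I J))"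

end

theory Submission
  imports Defs "Jordan_Normal_Form.Determinant"
begin

text \<open>A \<open>2 \<times> 2\<close> matrix with entries \<open>a, b, c, d\<close> is MDS iff all four entries and
  \<open>ad - bc\<close> are nonzero. So \<open>a, b, c\<close> are arbitrary nonzero elements, and \<open>d\<close> avoids exactly the
  two distinct values \<open>0\<close> and \<open>bc/a\<close>.\<close>

text \<open>Forwards, multiplicativity of \<open>det\<close> applies once the inverse is known to be
  square; backwards, a nonzero determinant makes \<open>A\<close> a unit of the matrix ring.\<close>

lemma invertible_mat_iff_det:
  fixes A :: "'a :: field mat"
  assumes A: "A \<in> carrier_mat n n"
  shows "invertible_mat A \<longleftrightarrow> det A \<noteq> 0"
proof
  assume "invertible_mat A"
  then obtain B where AB: "A * B = 1\<^sub>m n" and BA: "B * A = 1\<^sub>m (dim_row B)"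
    using A unfolding invertible_mat_def inverts_mat_def by auto
  \<comment> \<open>\<open>invertible_mat\<close> does not fix the size of the inverse, so it is
    read off from the sizes of the two products.\<close>
  have "dim_col B = n" using arg_cong[OF AB, of dim_col] by simp
  moreover have "dim_row B = n" using arg_cong[OF BA, of dim_col] A by simp
  ultimately have "B \<in> carrier_mat n n" by auto
  then show "det A \<noteq> 0" using det_mult[OF A, of B] AB by auto
next
  assume "det A \<noteq> 0"
  \<comment> \<open>\<open>()\<close> only fills the extension slot of the ring record.\<close>
  from det_non_zero_imp_unit[OF A this, of "()"]
  obtain B where "B \<in> carrier_mat n n" "A * B = 1\<^sub>m n" "B * A = 1\<^sub>m n"
    unfolding Units_def by (auto simp: ring_mat_simps)
  then show "invertible_mat A"
    using A unfolding invertible_mat_def inverts_mat_def by auto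
qed

text \<open>Laplace expansion along column 0: each minor is a 1 by 1 matrix, whose determinant is
  its single entry.\<close>

lemma det_mat_2:
  fixes A :: "'a :: comm_ring_1 mat"
  assumes A: "A \<in> carrier_mat 2 2"
  shows "det A = A $$ (0,0) * A $$ (1,1) - A $$ (0,1) * A $$ (1,0)"
proof -
  have "det (mat_delete A i 0) = mat_delete A i 0 $$ (0,0)" for i
    using A by (intro det_single) (auto simp: mat_delete_def)
  moreover have "mat_delete A 0 0 $$ (0,0) = A $$ (1,1)" "mat_delete A 1 0 $$ (0,0) = A $$ (0,1)"
    using A by (auto simp: mat_delete_def)
  ultimately show ?thesis
    using laplace_expansion_column[OF A, of 0]
    by (simp add: cofactor_def numeral_2_eq_2 algebra_simps)
qed

lemma submatrix_full:
  assumes "M \<in> carrier_mat n m"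
  shows "submatrix M {..<n} {..<m} = M"
proof (rule eq_matI)
  fix i j assume ij: "i < dim_row M" "j < dim_col M"
  \<comment> \<open>An entry moves to the position counting the selected indices below its own; with
    all indices selected, it stays in place.\<close>
  have "{a \<in> {..<n}. a < i} = {..<i}" "{a \<in> {..<m}. a < j} = {..<j}"
    using ij assms by auto
  then show "submatrix M {..<n} {..<m} $$ (i, j) = M $$ (i, j)"
    using submatrix_index_card[of i M j "{..<n}" "{..<m}"] ij assms by simp
qed (use assms in \<open>auto simp: dim_submatrix\<close>)

lemma submatrix_singletons:
  assumes "i < dim_row M" "j < dim_col M"
  shows "submatrix M {i} {j} = mat 1 1 (\<lambda>_. M $$ (i, j))"
proof -
  have "{a. a < dim_row M \<and> a \<in> {i}} = {i}" "{a. a < dim_col M \<and> a \<in> {j}} = {j}"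
    using assms by auto
  then have dims: "dim_row (submatrix M {i} {j}) = 1" "dim_col (submatrix M {i} {j}) = 1"
    by (simp_all only: dim_submatrix) simp_all
  \<comment> \<open>No selected index lies below the only one, so the entry lands at position
    0.\<close>
  have "{a \<in> {k}. a < k} = {}" for k :: nat by auto
  then have "submatrix M {i} {j} $$ (0, 0) = M $$ (i, j)"
    using submatrix_index_card[OF assms, of "{i}" "{j}"] by (simp only: card.empty singletonI)
  then show ?thesis
    by (intro eq_matI) (auto simp: dims)
qed

text \<open>Nonempty index sets of equal size inside \<open>{..<2}\<close> are either two
  singletons, selecting one entry, or both the whole set, selecting \<open>M\<close> itself.\<close>

lemma mds_matrix_2_iff:
  fixes M :: "'a :: field mat"
  assumes M: "M \<in> carrier_mat 2 2"
  shows "mds_matrix M \<longleftrightarrow> (\<forall>i<2. \<forall>j<2. M $$ (i, j) \<noteq> 0) \<and> det M \<noteq> 0"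
proof -
  have single: "invertible_mat (submatrix M {i} {j}) \<longleftrightarrow> M $$ (i, j) \<noteq> 0" if "i < 2" "j < 2" for i j
    using that M by (simp add: submatrix_singletons invertible_mat_iff_det[of _ 1] det_single)
  have full: "invertible_mat (submatrix M {..<2} {..<2}) \<longleftrightarrow> det M \<noteq> 0"
    by (simp add: submatrix_full[OF M] invertible_mat_iff_det[OF M])
  show ?thesis
  proof
    assume "mds_matrix M"
    then have inv: "invertible_mat (submatrix M I J)"
      if "I \<subseteq> {..<2}" "J \<subseteq> {..<2}" "card I = card J" "card I \<ge> 1" for I J
      using that M unfolding mds_matrix_def by auto
    have "M $$ (i, j) \<noteq> 0" if "i < 2" "j < 2" for i j
      using inv[of "{i}" "{j}"] single that by simp
    moreover have "det M \<noteq> 0"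
      using inv[of "{..<2}" "{..<2}"] full by simp
    ultimately show "(\<forall>i<2. \<forall>j<2. M $$ (i, j) \<noteq> 0) \<and> det M \<noteq> 0" by blast
  next
    assume R: "(\<forall>i<2. \<forall>j<2. M $$ (i, j) \<noteq> 0) \<and> det M \<noteq> 0"
    have "invertible_mat (submatrix M I J)"
      if I: "I \<subseteq> {..<2}" and J: "J \<subseteq> {..<2}" and c: "card I = card J" "card I \<ge> 1" for I J
    proof -
      have "card I \<le> 2" using card_mono[OF _ I] by simp
      then consider "card I = 1" | "card I = 2" using c by linarith
      then show ?thesis
      proof cases
        case 1
        then obtain i j where "I = {i}" "J = {j}"
          using c by (metis card_1_singletonE)
        then show ?thesis using single R I J by simp
      next
        case 2
        then have "I = {..<2}" "J = {..<2}"
          using c card_subset_eq[OF _ I] card_subset_eq[OF _ J] by simp_all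
        then show ?thesis using full R by simp
      qed
    qed
    then show "mds_matrix M" using M unfolding mds_matrix_def by auto
  qed
qed

lemma card_mds_matrix_2:
  "card {M :: 'a :: {field, finite} mat. M \<in> carrier_mat 2 2 \<and> mds_matrix M} =
    (CARD('a) - 1) ^ 3 * (CARD('a) - 2)"
proof -
  define f :: "('a \<times> 'a \<times> 'a) \<times> 'a \<Rightarrow> 'a mat" where
    "f = (\<lambda>((a, b, c), d). mat 2 2 (\<lambda>(i, j). if i = 0 then if j = 0 then a else b
                                             else if j = 0 then c else d))"
  define g :: "'a mat \<Rightarrow> ('a \<times> 'a \<times> 'a) \<times> 'a" where
    "g = (\<lambda>M. ((M $$ (0,0), M $$ (0,1), M $$ (1,0)), M $$ (1,1)))"
  define T :: "('a \<times> 'a \<times> 'a) set" where "T = (- {0}) \<times> (- {0}) \<times> (- {0})"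
  \<comment> \<open>For nonzero \<open>a\<close>, the value \<open>b * c / a\<close> is the only
    last entry with vanishing determinant. It varies with the triple, hence the dependent sum
    \<open>Sigma T D\<close>.\<close>
  define D :: "'a \<times> 'a \<times> 'a \<Rightarrow> 'a set" where "D = (\<lambda>(a, b, c). - {0, b * c / a})"
  have all2: "(\<forall>i<2. P i) \<longleftrightarrow> P 0 \<and> P (1 :: nat)" for P
    by (auto simp: numeral_2_eq_2 less_Suc_eq)
  have "bij_betw g {M. M \<in> carrier_mat 2 2 \<and> mds_matrix M} (Sigma T D)"
  proof (rule bij_betw_byWitness[where f' = f])
    show "\<forall>M \<in> {M. M \<in> carrier_mat 2 2 \<and> mds_matrix M}. f (g M) = M"
      by (auto simp: f_def g_def less_2_cases_iff intro!: eq_matI)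
    show "\<forall>x \<in> Sigma T D. g (f x) = x"
      by (auto simp: f_def g_def)
    show "g ` {M. M \<in> carrier_mat 2 2 \<and> mds_matrix M} \<subseteq> Sigma T D"
      by (auto simp: mds_matrix_2_iff det_mat_2 all2 g_def T_def D_def field_simps)
    show "f ` Sigma T D \<subseteq> {M. M \<in> carrier_mat 2 2 \<and> mds_matrix M}"
      by (auto simp: mds_matrix_2_iff det_mat_2 all2 f_def T_def D_def field_simps)
  qed
  then have "card {M :: 'a mat. M \<in> carrier_mat 2 2 \<and> mds_matrix M} = card (Sigma T D)"
    by (rule bij_betw_same_card)
  also have "\<dots> = (\<Sum>x\<in>T. card (D x))"
    by simp
  \<comment> \<open>All fibres over \<open>T\<close> have the same size: a product or quotient of
    nonzero field elements is nonzero, so the two excluded values never coincide.\<close>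
  also have "\<dots> = (\<Sum>x\<in>T. CARD('a) - 2)"
  proof (rule sum.cong)
    fix x assume "x \<in> T"
    then obtain a b c where x: "x = (a, b, c)" and "b * c / a \<noteq> 0"
      by (auto simp: T_def)
    then have "card {0, b * c / a} = 2" by simp
    then show "card (D x) = CARD('a) - 2"
      by (simp only: x D_def prod.case Compl_eq_Diff_UNIV card_Diff_subset[OF finite subset_UNIV])
  qed simp
  also have "\<dots> = (CARD('a) - 1) ^ 3 * (CARD('a) - 2)"
    by (simp add: T_def card_cartesian_product Compl_eq_Diff_UNIV card_Diff_subset power3_eq_cube)
  finally show ?thesis .
qed

theorem lemma6:
  fixes r :: nat
  assumes "CARD('a :: {field, finite}) = 2 ^ r"
  shows "card {M :: 'a mat. M \<in> carrier_mat 2 2 \<and> mds_matrix M} = (2 ^ r - 1) ^ 3 * (2 ^ r - 2)"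
  using card_mds_matrix_2[where 'a = 'a] unfolding assms .

end
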